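(* For nonnegative integers $n,k$ let $s(n,k)$ be the number of natural tests with cost $n$ and exactly $k$ distinct valid answers, and let $Q_k=\frac{k(k+1)(2k+1)}{6}$. Then for every integer $k>0$ and every integer $n\ge 0$, we have $s(n,k)=0$ if and only if $n<Q_k+k+1$ and $n\ne Q_k$.
   Context: A natural test is a finite multiset of positive integers (its answers; order is irrelevant). The cost of a test is the sum of all its answers with multiplicity, so a natural test of cost $n$ is a partition of $n$ (the empty test has cost $0$). A positive integer $a$ is a valid answer of a natural test if $a$ appears in the test exactly $a$ times. *)

theory Defs
  imports "HOL-Library.Multiset"
begin

definition natural_test :: "nat multiset \<Rightarrow> bool" where
  "natural_test T \<longleftrightarrow> (\<forall>a\<in>#T. 0 < a)"

definition cost :: "nat multiset \<Rightarrow> nat" where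
  "cost T = sum_mset T"

text \<open>Positivity is needed: \<open>count T 0 = 0\<close> holds for every natural test,
  but \<open>0\<close> is not a valid answer.\<close>

definition valid_answers :: "nat multiset \<Rightarrow> nat set" where
  "valid_answers T = {a. 0 < a \<and> count T a = a}"

definition s :: "nat \<Rightarrow> nat \<Rightarrow> nat" where
  "s n k = card {T. natural_test T \<and> cost T = n \<and> card (valid_answers T) = k}"

text \<open>The division is exact.\<close>

definition Q :: "nat \<Rightarrow> nat" where
  "Q k = k * (k + 1) * (2 * k + 1) div 6"

text \<open>The two cardinalities above are taken of finite sets.\<close>

lemma finite_valid_answers: "finite (valid_answers T)"
  by (rule finite_subset[of _ "set_mset T"])
     (auto simp: valid_answers_def simp flip: count_greater_zero_iff)

lemma finite_natural_tests: "finite {T. natural_test T \<and> cost T = n}"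
proof -
  have "{T. natural_test T \<and> cost T = n} \<subseteq> mset ` {xs. set xs \<subseteq> {..n} \<and> length xs \<le> n}"
  proof
    fix T assume T: "T \<in> {T. natural_test T \<and> cost T = n}"
    obtain xs where xs: "T = mset xs" using ex_mset by metis
    have pos: "\<forall>x\<in>set xs. 0 < x" and sum: "sum_list xs = n"
      using T by (auto simp: xs natural_test_def cost_def sum_mset_sum_list)
    have "length xs \<le> sum_list xs"
      using pos by (induction xs) auto
    moreover have "set xs \<subseteq> {..n}"
      using sum member_le_sum_list by auto
    ultimately show "T \<in> mset ` {xs. set xs \<subseteq> {..n} \<and> length xs \<le> n}"
      using xs sum by auto
  qed
  then show ?thesis
    by (rule finite_subset) (simp add: finite_lists_length_le)
qed

lemma six_times_Q: "6 * Q k = k * (k + 1) * (2 * k + 1)"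
proof -
  have "6 dvd k * (k + 1) * (2 * k + 1)"
  proof (induction k)
    case (Suc k)
    have "Suc k * (Suc k + 1) * (2 * Suc k + 1)
        = k * (k + 1) * (2 * k + 1) + 6 * (k + 1) * (k + 1)"
      by (simp add: algebra_simps)
    also have "6 dvd \<dots>"
      using Suc by (intro dvd_add) (simp_all add: mult.assoc)
    finally show ?case .
  qed simp
  then show ?thesis by (simp add: Q_def)
qed

end

theory Submission
  imports Defs
begin

text \<open>
  A test whose set of valid answers is \<open>A\<close> must contain \<open>a\<close> copies of every \<open>a \<in> A\<close>. These
  forced copies form the test \<open>core A\<close>, of cost \<open>\<Sum>a\<in>A. a\<^sup>2\<close>, so everything depends on how small
  a sum of \<open>k\<close> distinct positive squares can be, and on what can be added to a cheapest core.

  The smallest sum is \<open>Q k\<close>, attained by \<open>A = {1..k}\<close>. Any other \<open>A\<close> has a maximum of at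
  least \<open>k + 1\<close>, while its other \<open>k - 1\<close> elements contribute at least \<open>Q (k - 1)\<close>, so that the
  cost is at least \<open>Q (k - 1) + (k + 1)\<^sup>2 = Q k + 2 * k + 1\<close>. For \<open>A = {1..k}\<close> the number of
  copies of every answer up to \<open>k\<close> is already fixed by the core, so either nothing is added, or
  something is added that is at least \<open>k + 1\<close>. Hence no cost below \<open>Q k + k + 1\<close> other than
  \<open>Q k\<close> occurs (\<open>cost_gap\<close>).

  Conversely, a single additional answer \<open>m \<ge> k + 1\<close> can be put on top of \<open>core {1..k}\<close>: since
  \<open>m > 1\<close> occurs only once, it is not valid, and the cost is \<open>Q k + m\<close>.
\<close>

lemma Q_0: "Q 0 = 0"
  by (simp add: Q_def)

lemma Q_Suc: "Q (Suc k) = Q k + (Suc k)\<^sup>2"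
proof -
  have "6 * Q (Suc k) = 6 * (Q k + (Suc k)\<^sup>2)"
    by (simp only: six_times_Q distrib_left) (simp add: power2_eq_square algebra_simps)
  then show ?thesis by simp
qed

lemma sum_squares_eq_Q: "(\<Sum>a\<in>{1..k}. a\<^sup>2) = Q k"
  by (induction k) (simp_all add: Q_0 Q_Suc)

lemma card_le_Max_of_pos:
  fixes A :: "nat set"
  assumes "finite A" "0 \<notin> A"
  shows "A \<subseteq> {1..Max A}" and "card A \<le> Max A"
proof -
  show sub: "A \<subseteq> {1..Max A}"
    using assms by (auto simp: Suc_le_eq intro: gr0I)
  show "card A \<le> Max A"
    using card_mono[OF _ sub] by simp
qed

text \<open>
  Removing the largest element, which is at least the number of elements, is the right
  induction step because \<open>Q\<close> grows by exactly the square of that number.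
\<close>

lemma Q_card_le_sum_squares:
  fixes A :: "nat set"
  assumes "finite A" "0 \<notin> A"
  shows "Q (card A) \<le> (\<Sum>a\<in>A. a\<^sup>2)"
  using assms
proof (induction "card A" arbitrary: A)
  case 0
  then show ?case by (simp add: Q_0)
next
  case (Suc k)
  have mem: "Max A \<in> A"
    using Suc.hyps(2) Suc.prems(1) by (intro Max_in) auto
  have "Q k \<le> (\<Sum>a\<in>A - {Max A}. a\<^sup>2)"
    using Suc mem by (metis Diff_iff card_Diff_singleton diff_Suc_1 finite_Diff)
  moreover have "(Suc k)\<^sup>2 \<le> (Max A)\<^sup>2"
    using card_le_Max_of_pos(2)[OF Suc.prems] Suc.hyps(2) by (intro power_mono) auto
  ultimately show ?case
    using sum.remove[OF Suc.prems(1) mem, of "\<lambda>a. a\<^sup>2"] Suc.hyps(2)[symmetric]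
    by (simp add: Q_Suc del: power_Suc power_mono_iff)
qed

lemma sum_squares_not_initial:
  fixes A :: "nat set"
  assumes "finite A" "0 \<notin> A" "A \<noteq> {1..card A}"
  shows "Q (card A) + 2 * card A + 1 \<le> (\<Sum>a\<in>A. a\<^sup>2)"
proof -
  have "A \<noteq> {}" using assms(3) by auto
  then have mem: "Max A \<in> A" using assms(1) by (intro Max_in)
  obtain k where k: "card A = Suc k"
    using assms(1) \<open>A \<noteq> {}\<close> by (cases "card A") auto
  have "Max A \<noteq> card A"
    \<comment> \<open>otherwise \<open>A\<close> would fill the whole interval below its maximum\<close>
    using card_subset_eq[OF _ card_le_Max_of_pos(1)[OF assms(1,2)]] assms(3) by auto
  then have "Suc (Suc k) \<le> Max A"
    using card_le_Max_of_pos(2)[OF assms(1,2)] k by simp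
  then have "(Suc (Suc k))\<^sup>2 \<le> (Max A)\<^sup>2"
    by (intro power_mono) auto
  moreover have "Q k \<le> (\<Sum>a\<in>A - {Max A}. a\<^sup>2)"
    using Q_card_le_sum_squares[of "A - {Max A}"] assms(1,2) mem k by simp
  ultimately show ?thesis
    using sum.remove[OF assms(1) mem, of "\<lambda>a. a\<^sup>2"] k
    by (simp add: Q_Suc power2_eq_square)
qed

definition core :: "nat set \<Rightarrow> nat multiset" where
  "core A = (\<Sum>a\<in>A. replicate_mset a a)"

lemma count_core:
  assumes "finite A"
  shows "count (core A) b = (if b \<in> A then b else 0)"
  using assms by (simp add: core_def count_sum)

lemma cost_core: "cost (core A) = (\<Sum>a\<in>A. a\<^sup>2)"
  unfolding core_def cost_def
  by (induction A rule: infinite_finite_induct) (auto simp: power2_eq_square sum_mset_replicate_mset)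

lemma natural_test_core: "finite A \<Longrightarrow> natural_test (core A)"
  by (auto simp: natural_test_def count_core simp flip: count_greater_zero_iff split: if_splits)

lemma cost_add: "cost (S + T) = cost S + cost T"
  by (simp add: cost_def)

lemma core_valid_answers_subseteq: "core (valid_answers T) \<subseteq># T"
proof (rule mset_subset_eqI)
  fix a
  have "count T a = a" if "a \<in> valid_answers T"
    using that by (simp add: valid_answers_def)
  then show "count (core (valid_answers T)) a \<le> count T a"
    by (simp add: count_core[OF finite_valid_answers])
qed

text \<open>
  The costs \<open>Q k + 1, \<dots>, Q k + k\<close> are too small for valid answers other than \<open>1, \<dots>, k\<close>.
  With these, they could be reached only by adding copies of \<open>1, \<dots>, k\<close> to the core, and each
  such copy would destroy the validity of its answer.
\<close>

lemma cost_gap: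
  assumes "natural_test T" and k: "card (valid_answers T) = k"
  shows "cost T = Q k \<or> Q k + k + 1 \<le> cost T"
proof -
  let ?A = "valid_answers T"
  define R where "R = T - core ?A"
  have T: "T = core ?A + R"
    using core_valid_answers_subseteq by (simp add: R_def)
  then have cost: "cost T = (\<Sum>a\<in>?A. a\<^sup>2) + cost R"
    by (metis cost_add cost_core)
  have A: "finite ?A" "0 \<notin> ?A"
    by (auto simp: finite_valid_answers) (simp add: valid_answers_def)
  show ?thesis
  proof (cases "?A = {1..k}")
    case False
    then show ?thesis
      using sum_squares_not_initial[OF A] k cost by simp
  next
    case True
    then have cost': "cost T = Q k + cost R"
      using cost sum_squares_eq_Q by simp
    show ?thesis
    proof (cases "R = {#}")
      case True
      then show ?thesis using cost' by (simp add: cost_def)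
    next
      case False
      then obtain b where b: "b \<in># R" by blast
      have "b \<notin> ?A"
      proof
        assume "b \<in> ?A"
        moreover from this have "count T b = b" by (simp add: valid_answers_def)
        ultimately have "count R b = 0" by (simp add: R_def count_core[OF A(1)])
        with b show False by (simp flip: count_greater_zero_iff)
      qed
      moreover have "0 < b"
        using b assms(1) by (auto simp: R_def natural_test_def dest: in_diffD)
      ultimately have "k + 1 \<le> b" using True by simp
      also have "b \<le> cost R"
        using multi_member_split[OF b] by (auto simp: cost_def)
      finally show ?thesis using cost' by simp
    qed
  qed
qed

lemma valid_answers_core: "valid_answers (core {1..k}) = {1..k}"
  by (auto simp: valid_answers_def count_core split: if_splits)

text \<open>
  The bound \<open>k < m\<close> keeps the answers of the core valid, and \<open>k > 0\<close> excludes \<open>m = 1\<close>, the only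
  answer that becomes valid by occurring once.
\<close>

lemma valid_answers_add_mset_core:
  assumes "0 < k" "k < m"
  shows "valid_answers (add_mset m (core {1..k})) = {1..k}"
  using assms by (auto simp: valid_answers_def count_core split: if_splits)

lemma s_eq_0_iff:
  "s n k = 0 \<longleftrightarrow> (\<nexists>T. natural_test T \<and> cost T = n \<and> card (valid_answers T) = k)"
proof -
  have "finite {T. natural_test T \<and> cost T = n \<and> card (valid_answers T) = k}"
    by (rule finite_subset[OF _ finite_natural_tests[of n]]) auto
  then show ?thesis by (simp add: s_def)
qed

theorem theorem5:
  fixes n k :: nat
  assumes "k > 0"
  shows "s n k = 0 \<longleftrightarrow> n < Q k + k + 1 \<and> n \<noteq> Q k"
proof
  assume "s n k = 0"
  then have none: "cost T \<noteq> n" if "natural_test T" "valid_answers T = {1..k}" for T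
    using that unfolding s_eq_0_iff by fastforce
  have core: "cost (core {1..k}) = Q k"
    using cost_core sum_squares_eq_Q by simp
  then have "n \<noteq> Q k"
    using none[OF natural_test_core valid_answers_core] by auto
  moreover have False if "Q k + k + 1 \<le> n"
  proof -
    define m where "m = n - Q k"
    have m: "k < m" "n = Q k + m" using that by (auto simp: m_def)
    have "natural_test (add_mset m (core {1..k}))"
      using natural_test_core[of "{1..k}"] m by (simp add: natural_test_def)
    moreover have "cost (add_mset m (core {1..k})) = n"
      using core m by (simp add: cost_def)
    ultimately show False
      using none valid_answers_add_mset_core[OF assms m(1)] by blast
  qed
  ultimately show "n < Q k + k + 1 \<and> n \<noteq> Q k" by fastforce
next
  assume "n < Q k + k + 1 \<and> n \<noteq> Q k"
  then show "s n k = 0"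
    unfolding s_eq_0_iff using cost_gap by fastforce
qed

end
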